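(* Let $a:\mathbb{N}\to\mathbb{C}$ be an arithmetic function and let $w\ge 1$. Define, for $y>0$, the Dirichlet polynomial $D_w(y):=\sum_{n\le y}a(n)/n^{w}$ and $F_w(y):=\sum_{n\le y}a(n)\left\{\frac{n}{y}\right\}/n^{w}$. Then $D_w$ is a solution of the Volterra integral equation $$D_w(y)=F_w(y)+\frac{1}{y}\int_{0}^{y}D_w(y_0)\,dy_0.$$ Furthermore, we have the Neumann-type series $$D_w(y)=F_w(y)+\frac{1}{y}\int_{0}^{y}F_w(y_0)\,dy_0+\sum_{k\ge1}\frac{1}{y}\int_{0}^{y}\int_{0}^{y_0}\cdots\int_{0}^{y_{k-1}}\frac{F_w(y_k)}{y_0y_1\cdots y_{k-1}}\,dy_0\cdots dy_k.$$
   Context: $\{x\}$ denotes the fractional part of the real number $x$.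
   Formalization: Both identities are stated for y > 0 other than integers m with a(m) ≠ 0; at such y = m they fail by a(m)/m^w, since {m/m} = 0 (e.g. a(1) = 1, y = 1: D_w = 1, F_w = 0, integral 0). *)

theory Defs
  imports "HOL-Analysis.Analysis"
begin

text \<open>Arithmetic functions live on the positive integers, so the value \<open>a 0\<close> is never used.\<close>

definition dirichlet_poly :: "(nat \<Rightarrow> complex) \<Rightarrow> real \<Rightarrow> real \<Rightarrow> complex" where
  "dirichlet_poly a w y = (\<Sum>n | 1 \<le> n \<and> real n \<le> y. a n / of_real (real n powr w))"

text \<open>At an integer point \<open>y = n\<close> the last summand carries the factor \<open>frac 1 = 0\<close>,
  whereas \<open>frac (n / y) = n / y\<close> for \<open>n < y\<close>.  So at \<open>y = n\<close> the function below
  loses the term \<open>a n / n powr w\<close>, although \<open>dirichlet_poly a w\<close> contains it.\<close>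

definition frac_dirichlet_poly :: "(nat \<Rightarrow> complex) \<Rightarrow> real \<Rightarrow> real \<Rightarrow> complex" where
  "frac_dirichlet_poly a w y =
     (\<Sum>n | 1 \<le> n \<and> real n \<le> y. a n * of_real (frac (real n / y)) / of_real (real n powr w))"

text \<open>\<open>iterated_integral k g y\<close> is the \<open>(k + 1)\<close>-fold iterated integral of
  \<open>g [y\<^sub>0, \<dots>, y\<^sub>k]\<close>, where \<open>y\<^sub>0\<close> (outermost) runs over \<open>{0..y}\<close> and each
  \<open>y\<^sub>i\<^sub>+\<^sub>1\<close> over \<open>{0..y\<^sub>i}\<close>.\<close>

fun iterated_integral :: "nat \<Rightarrow> (real list \<Rightarrow> complex) \<Rightarrow> real \<Rightarrow> complex" where
  "iterated_integral 0 g y = integral {0..y} (\<lambda>t. g [t])"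
| "iterated_integral (Suc k) g y =
     integral {0..y} (\<lambda>t. iterated_integral k (\<lambda>ts. g (t # ts)) t)"

definition neumann_term :: "(real \<Rightarrow> complex) \<Rightarrow> real \<Rightarrow> nat \<Rightarrow> complex" where
  "neumann_term F y k =
     1 / of_real y * iterated_integral k (\<lambda>ys. F (ys ! k) / of_real (\<Prod>i<k. ys ! i)) y"

end

theory Submission
  imports Defs
begin

text \<open>Let \<open>T g y = 1 / y * integral {0..y} g\<close>.  Integrating the step function \<open>D\<close> gives
  \<open>D = F + T D\<close> off the integers of the support of \<open>a\<close>, and the \<open>k\<close>-th Neumann term is
  \<open>T\<^sup>k\<^sup>+\<^sup>1 F = T\<^sup>k\<^sup>+\<^sup>1 D - T\<^sup>k\<^sup>+\<^sup>2 D\<close>, so the series telescopes to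
  \<open>T D - lim T\<^sup>k D\<close>.  Since \<open>D\<close> vanishes on \<open>[0, 1)\<close>, we have \<open>\<bar>D t\<bar> \<le> M t\<close> on \<open>[0, y]\<close>, and
  \<open>T\<close> halves the function \<open>t\<close>; hence \<open>\<bar>T\<^sup>k D t\<bar> \<le> M t / 2\<^sup>k\<close> tends to \<open>0\<close>.\<close>

definition mean_op :: "(real \<Rightarrow> complex) \<Rightarrow> real \<Rightarrow> complex" where
  "mean_op g y = 1 / of_real y * integral {0..y} g"

lemma iterated_integral_cmult:
  "iterated_integral k (\<lambda>ts. c * g ts) y = c * iterated_integral k g y"
  by (induction k arbitrary: g y) auto

lemma neumann_term_0: "neumann_term F y 0 = mean_op F y"
  by (simp add: neumann_term_def mean_op_def)

text \<open>The factor coming from the outermost variable is constant in the inner ones. Once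
  \<open>iterated_integral_cmult\<close> pulls it out, the inner integrals form the preceding term
  at that variable, so the terms are iterated means of \<open>F\<close>.\<close>

lemma neumann_term_Suc: "neumann_term F y (Suc k) = mean_op (\<lambda>t. neumann_term F t k) y"
proof -
  have "iterated_integral k (\<lambda>ts. F ((t # ts) ! Suc k) / of_real (\<Prod>i<Suc k. (t # ts) ! i)) t
      = neumann_term F t k" for t
  proof -
    have "F ((t # ts) ! Suc k) / of_real (\<Prod>i<Suc k. (t # ts) ! i)
        = 1 / of_real t * (F (ts ! k) / of_real (\<Prod>i<k. ts ! i))" for ts
      by (subst prod.lessThan_Suc_shift) simp
    then show ?thesis
      by (simp only: iterated_integral_cmult neumann_term_def)
  qed
  then show ?thesis
    by (simp add: neumann_term_def[of F y] mean_op_def)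
qed

text \<open>A class stable under \<open>mean_op\<close>, on which the constant \<open>M\<close>
  contracts. The bound forces \<open>g 0 = 0\<close>, in agreement with
  \<open>mean_op g 0 = 0\<close>, which comes from \<open>1 / 0 = 0\<close>.\<close>

definition linearly_bounded :: "real \<Rightarrow> real \<Rightarrow> (real \<Rightarrow> complex) \<Rightarrow> bool" where
  "linearly_bounded Y M g \<longleftrightarrow> g integrable_on {0..Y} \<and> (\<forall>t\<in>{0..Y}. norm (g t) \<le> M * t)"

text \<open>Source of the factor 1/2: the mean of \<open>M * s\<close> over \<open>{0..t}\<close> is
  \<open>M * t / 2\<close>.\<close>

lemma norm_mean_op_le:
  assumes g: "linearly_bounded Y M g" and t: "t \<in> {0..Y}"
  shows "norm (mean_op g t) \<le> M / 2 * t"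
proof (cases "t = 0")
  case False
  then have t0: "t > 0" using t by simp
  have "((\<lambda>s. M * s) has_integral (M * (t\<^sup>2 / 2) - M * (0\<^sup>2 / 2))) {0..t}"
    using t by (intro fundamental_theorem_of_calculus)
      (auto intro!: derivative_eq_intros simp flip: has_real_derivative_iff_has_vector_derivative)
  moreover have "g integrable_on {0..t}"
    using g t by (auto simp: linearly_bounded_def intro: integrable_on_subinterval)
  ultimately have "norm (integral {0..t} g) \<le> M * (t\<^sup>2 / 2)"
    using g t integral_norm_bound_integral[of g "{0..t}" "\<lambda>s. M * s"]
    by (auto simp: linearly_bounded_def has_integral_iff)
  then have "norm (integral {0..t} g) / t \<le> M * (t\<^sup>2 / 2) / t"
    using t0 by (intro divide_right_mono) auto
  then show ?thesis
    using t0 by (simp add: mean_op_def norm_mult norm_divide power2_eq_square)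
qed (simp add: mean_op_def)

text \<open>Integrability of \<open>mean_op g\<close> follows from its continuity. Away from 0 it is
  a quotient of continuous functions; only the point 0 calls for the linear bound.\<close>

lemma linearly_bounded_mean_op:
  assumes g: "linearly_bounded Y M g"
  shows "linearly_bounded Y (M / 2) (mean_op g)"
proof -
  have int: "continuous_on {0..Y} (\<lambda>t. integral {0..t} g)"
    using g by (intro indefinite_integral_continuous_1) (simp add: linearly_bounded_def)
  have "continuous_on {0..Y} (mean_op g)"
  proof (unfold continuous_on_eq_continuous_within, intro ballI)
    fix x assume x: "x \<in> {0..Y}"
    show "continuous (at x within {0..Y}) (mean_op g)"
    proof (cases "x = 0")
      case True
      \<comment> \<open>The linear bound squeezes \<open>mean_op g\<close> to 0, which is also its
        value at 0.\<close>
      have "((\<lambda>t. M / 2 * t) \<longlongrightarrow> M / 2 * 0) (at 0 within {0..Y})"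
        by (intro tendsto_intros)
      then have lim: "((\<lambda>t. M / 2 * t) \<longlongrightarrow> 0) (at 0 within {0..Y})"
        by simp
      have "\<forall>\<^sub>F t in at 0 within {0..Y}. t \<in> {0..Y}"
        by (simp add: eventually_at_filter)
      then have "\<forall>\<^sub>F t in at 0 within {0..Y}. norm (mean_op g t) \<le> M / 2 * t"
        by (rule eventually_mono) (rule norm_mean_op_le[OF g])
      then have "(mean_op g \<longlongrightarrow> 0) (at 0 within {0..Y})"
        using lim by (rule Lim_null_comparison)
      then show ?thesis
        using True by (simp add: continuous_within mean_op_def)
    next
      case False
      moreover have "continuous (at x within {0..Y}) (\<lambda>t. integral {0..t} g)"
        using int x by (auto simp: continuous_on_eq_continuous_within)
      ultimately show ?thesis
        unfolding mean_op_def by (intro continuous_intros) auto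
    qed
  qed
  then show ?thesis
    using norm_mean_op_le[OF g]
    by (auto simp: linearly_bounded_def intro: integrable_continuous_interval)
qed

lemma linearly_bounded_mean_op_funpow:
  "linearly_bounded Y M g \<Longrightarrow> linearly_bounded Y (M / 2 ^ k) ((mean_op ^^ k) g)"
proof (induction k)
  case (Suc k)
  from linearly_bounded_mean_op[OF Suc.IH[OF Suc.prems]] show ?case
    by (simp add: mult.commute)
qed simp

lemma mean_op_funpow_tendsto_0:
  assumes "linearly_bounded Y M g" and "t \<in> {0..Y}"
  shows "(\<lambda>k. (mean_op ^^ k) g t) \<longlonglongrightarrow> 0"
proof (rule Lim_null_comparison)
  show "\<forall>\<^sub>F k in sequentially. norm ((mean_op ^^ k) g t) \<le> M * t * (1 / 2) ^ k"
    using linearly_bounded_mean_op_funpow[OF assms(1)] assms(2)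
    by (auto simp: linearly_bounded_def power_divide)
  show "(\<lambda>k. M * t * (1 / 2) ^ k) \<longlonglongrightarrow> 0"
    by (intro tendsto_mult_right_zero LIMSEQ_power_zero) simp
qed

text \<open>Already the term for \<open>k = 0\<close> is an integral of \<open>F\<close>, so the
  finite set \<open>S\<close> is invisible and the identity holds at every point of
  \<open>{0..Y}\<close>, including those of \<open>S\<close>. Applying \<open>mean_op\<close> to
  both sides gives the induction step.\<close>

lemma neumann_term_telescope:
  assumes g: "linearly_bounded Y M g" and "finite S"
    and F: "\<And>t. t \<in> {0..Y} - S \<Longrightarrow> F t = g t - mean_op g t"
    and "t \<in> {0..Y}"
  shows "neumann_term F t k = (mean_op ^^ Suc k) g t - (mean_op ^^ Suc (Suc k)) g t"
  using \<open>t \<in> {0..Y}\<close>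
proof (induction k arbitrary: t)
  case 0
  have sub: "{0..t} \<subseteq> {0..Y}" using 0 by auto
  have "integral {0..t} F = integral {0..t} (\<lambda>s. g s - mean_op g s)"
    using F sub \<open>finite S\<close> by (intro integral_spike[of S]) (auto simp: negligible_finite)
  also have "\<dots> = integral {0..t} g - integral {0..t} (mean_op g)"
    using g linearly_bounded_mean_op[OF g] sub
    by (intro integral_diff) (auto simp: linearly_bounded_def intro: integrable_on_subinterval)
  finally show ?case
    by (simp add: neumann_term_0 mean_op_def[of F] mean_op_def[of g t] mean_op_def[of "mean_op g"]
        right_diff_distrib diff_divide_distrib)
next
  case (Suc k)
  have sub: "{0..t} \<subseteq> {0..Y}" using Suc.prems by auto
  let ?h = "\<lambda>k. (mean_op ^^ k) g"
  have int: "?h j integrable_on {0..t}" for j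
    using linearly_bounded_mean_op_funpow[OF g, of j] sub
    by (auto simp: linearly_bounded_def intro: integrable_on_subinterval)
  have "integral {0..t} (\<lambda>s. neumann_term F s k)
      = integral {0..t} (\<lambda>s. ?h (Suc k) s - ?h (Suc (Suc k)) s)"
    using Suc.IH sub by (intro integral_cong) auto
  also have "\<dots> = integral {0..t} (?h (Suc k)) - integral {0..t} (?h (Suc (Suc k)))"
    using int[of "Suc k"] int[of "Suc (Suc k)"] by (rule integral_diff)
  finally have "mean_op (\<lambda>s. neumann_term F s k) t
      = mean_op (?h (Suc k)) t - mean_op (?h (Suc (Suc k))) t"
    by (simp only: mean_op_def right_diff_distrib)
  then show ?case
    by (simp add: neumann_term_Suc)
qed

lemma neumann_term_sums:
  assumes "linearly_bounded Y M g" and "finite S"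
    and "\<And>t. t \<in> {0..Y} - S \<Longrightarrow> F t = g t - mean_op g t"
    and "t \<in> {0..Y}"
  shows "neumann_term F t sums mean_op g t"
proof -
  have "(\<lambda>k. (mean_op ^^ Suc k) g t) \<longlonglongrightarrow> 0"
    using mean_op_funpow_tendsto_0[OF assms(1,4)] by (rule LIMSEQ_Suc)
  from telescope_sums'[OF this]
  have "(\<lambda>k. neumann_term F t k) sums ((mean_op ^^ Suc 0) g t - 0)"
    by (simp only: neumann_term_telescope[OF assms])
  then show ?thesis
    by simp
qed

lemma finite_nat_between: "finite {n. 1 \<le> n \<and> real n \<le> y}"
  by (rule finite_subset[of _ "{..nat \<lfloor>y\<rfloor>}"]) (auto simp: le_nat_floor)

text \<open>The \<open>n\<close>-th coefficient is present exactly on \<open>{real n..y}\<close>, an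
  interval of length \<open>y - real n\<close>.\<close>

lemma has_integral_dirichlet_poly:
  assumes "y \<ge> 0"
  shows "(dirichlet_poly a w has_integral
    (\<Sum>n | 1 \<le> n \<and> real n \<le> y. of_real (y - real n) * (a n / of_real (real n powr w)))) {0..y}"
proof -
  let ?A = "{n. 1 \<le> n \<and> real n \<le> y}"
  let ?c = "\<lambda>n. a n / of_real (real n powr w)"
  have "((\<lambda>t. if t \<in> {real n..y} then ?c n else 0) has_integral (of_real (y - real n) * ?c n)) {0..y}"
    if "n \<in> ?A" for n
  proof (subst has_integral_restrict)
    show "((\<lambda>_. ?c n) has_integral of_real (y - real n) * ?c n) {real n..y}"
      using has_integral_const_real[of "?c n" "real n" y] that by (simp add: scaleR_conv_of_real)
  qed auto
  then have "((\<lambda>t. \<Sum>n\<in>?A. if t \<in> {real n..y} then ?c n else 0) has_integral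
      (\<Sum>n\<in>?A. of_real (y - real n) * ?c n)) {0..y}"
    by (intro has_integral_sum finite_nat_between)
  moreover have "(\<Sum>n\<in>?A. if t \<in> {real n..y} then ?c n else 0) = dirichlet_poly a w t"
    if "t \<in> {0..y}" for t
    unfolding dirichlet_poly_def using that
    by (intro sum.mono_neutral_cong_right finite_nat_between) auto
  ultimately show ?thesis
    by (rule has_integral_eq[rotated])
qed

text \<open>If any summand is present at \<open>t\<close>, then \<open>1 \<le> t\<close>, so
  multiplying each norm by \<open>t\<close> does not decrease it.\<close>

lemma linearly_bounded_dirichlet_poly:
  assumes "y \<ge> 0"
  shows "linearly_bounded y (\<Sum>n | 1 \<le> n \<and> real n \<le> y. norm (a n / of_real (real n powr w)))
    (dirichlet_poly a w)"
proof -
  let ?c = "\<lambda>n. a n / of_real (real n powr w)"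
  have "norm (dirichlet_poly a w t) \<le> (\<Sum>n | 1 \<le> n \<and> real n \<le> y. norm (?c n)) * t"
    if t: "t \<in> {0..y}" for t
  proof -
    have "norm (dirichlet_poly a w t) \<le> (\<Sum>n | 1 \<le> n \<and> real n \<le> t. norm (?c n))"
      unfolding dirichlet_poly_def by (rule norm_sum)
    also have "\<dots> \<le> (\<Sum>n | 1 \<le> n \<and> real n \<le> t. norm (?c n) * t)"
    proof (rule sum_mono)
      fix n assume "n \<in> {n. 1 \<le> n \<and> real n \<le> t}"
      then have "1 \<le> t" by auto
      then show "norm (?c n) \<le> norm (?c n) * t"
        by (metis mult.right_neutral mult_left_mono norm_ge_zero)
    qed
    also have "\<dots> \<le> (\<Sum>n | 1 \<le> n \<and> real n \<le> y. norm (?c n) * t)"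
      using t by (intro sum_mono2 finite_nat_between) auto
    finally show ?thesis
      by (simp add: sum_distrib_right)
  qed
  then show ?thesis
    using has_integral_dirichlet_poly[OF assms, of a w]
    by (auto simp: linearly_bounded_def has_integral_iff)
qed

text \<open>Termwise this is \<open>1 = n / y + (y - n) / y\<close>, since the fractional part of
  \<open>n / y\<close> is \<open>n / y\<close> for \<open>n < y\<close>. At \<open>n = y\<close>
  both weights on the right are 0, so the coefficient there has to vanish.\<close>

lemma dirichlet_poly_volterra:
  assumes "y > 0" and y: "y \<notin> real ` {n. a n \<noteq> 0}"
  shows "dirichlet_poly a w y = frac_dirichlet_poly a w y + mean_op (dirichlet_poly a w) y"
proof -
  let ?A = "{n. 1 \<le> n \<and> real n \<le> y}"
  let ?c = "\<lambda>n. a n / of_real (real n powr w)"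
  have "?c n = a n * of_real (frac (real n / y)) / of_real (real n powr w)
      + 1 / of_real y * (of_real (y - real n) * ?c n)" if n: "n \<in> ?A" for n
  proof (cases "a n = 0")
    case False
    then have "real n < y" using y n by (auto simp: order.order_iff_strict)
    then have frac: "frac (real n / y) = real n / y"
      using \<open>y > 0\<close> by (simp add: frac_eq)
    show ?thesis
      unfolding frac using \<open>y > 0\<close> n by (simp add: field_simps)
  qed simp
  then have "(\<Sum>n\<in>?A. ?c n) = (\<Sum>n\<in>?A. a n * of_real (frac (real n / y)) / of_real (real n powr w)
      + 1 / of_real y * (of_real (y - real n) * ?c n))"
    by (intro sum.cong) blast+
  moreover have "integral {0..y} (dirichlet_poly a w) = (\<Sum>n\<in>?A. of_real (y - real n) * ?c n)"
    using \<open>y > 0\<close> by (intro integral_unique has_integral_dirichlet_poly) simp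
  ultimately show ?thesis
    by (simp only: mean_op_def dirichlet_poly_def[of a w y] frac_dirichlet_poly_def
        sum.distrib sum_distrib_left)
qed

theorem theorem3:
  fixes a :: "nat \<Rightarrow> complex" and w y :: real
  assumes "w \<ge> 1" and "y > 0"
    and "y \<notin> real ` {n. a n \<noteq> 0}"
  shows "dirichlet_poly a w y =
           frac_dirichlet_poly a w y + 1 / of_real y * integral {0..y} (dirichlet_poly a w) \<and>
         summable (\<lambda>k. neumann_term (frac_dirichlet_poly a w) y (Suc k)) \<and>
         dirichlet_poly a w y =
           frac_dirichlet_poly a w y + 1 / of_real y * integral {0..y} (frac_dirichlet_poly a w) +
           (\<Sum>k. neumann_term (frac_dirichlet_poly a w) y (Suc k))"
proof -
  let ?D = "dirichlet_poly a w" and ?F = "frac_dirichlet_poly a w"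
  \<comment> \<open>All integers in \<open>{0..y}\<close>, not just those with nonzero coefficient:
    the set is finite, and it contains 0, where \<open>dirichlet_poly_volterra\<close> does not
    apply.\<close>
  let ?S = "real ` {..nat \<lfloor>y\<rfloor>}"
  have volterra: "?D y = ?F y + mean_op ?D y"
    using assms(2,3) by (rule dirichlet_poly_volterra)
  have "?F t = ?D t - mean_op ?D t" if t: "t \<in> {0..y} - ?S" for t
  proof -
    have "t \<notin> range real"
      using t by (auto simp: le_nat_floor)
    moreover from this have "t \<noteq> 0"
      by (metis of_nat_0 rangeI)
    ultimately have "?D t = ?F t + mean_op ?D t"
      using t by (intro dirichlet_poly_volterra) auto
    then show ?thesis by simp
  qed
  with linearly_bounded_dirichlet_poly[of y a w] assms(2)
  have "neumann_term ?F y sums mean_op ?D y"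
    by (intro neumann_term_sums[where S = ?S]) auto
  \<comment> \<open>The term of index 0 is \<open>mean_op ?F y\<close>, which the claim lists
    separately from the series.\<close>
  then have sum: "(\<lambda>k. neumann_term ?F y (Suc k)) sums (mean_op ?D y - mean_op ?F y)"
    by (simp add: sums_Suc_iff neumann_term_0)
  have "?D y = ?F y + mean_op ?F y + (\<Sum>k. neumann_term ?F y (Suc k))"
    using volterra by (simp flip: sums_unique[OF sum])
  with volterra sums_summable[OF sum] show ?thesis
    unfolding mean_op_def by blast
qed

end
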